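(* Let $n,f$ be integers with $1\le 2f\le n-1$ (i.e. $f\ge1$ and $n>2f$) and $\Pi$ a set of $n$ processes. There is an algorithm using the consistent oracle ${}^c\mathcal O.f\text{-TAg}(\Pi,f)$ that solves $(f+1)\text{-TAg}(\Pi,f)$; hence $(f+1)\text{-TAg}(n,f)$ is ${}^cC$-reducible to $f\text{-TAg}(n,f)$ (and therefore so is $\mathrm{Cons}(n,f)$).
   Context: Model: a finite set of processes runs an asynchronous algorithm communicating by reliable message passing with unbounded delays and speeds; processes fail only by crashing. Time is $\mathcal T=\mathbb N$; a failure pattern $F$ for $\Pi$ is a nondecreasing map $\mathcal T\to2^\Pi$, $Faulty(F)=\bigcup_tF(t)$. A binary agreement problem $P$ for $\Pi$ maps each $(F,\vec V)$, $\vec V\in\{0,1\}^\Pi$, to a nonempty $P(F,\vec V)\subseteq\{0,1\}$; a task is $T=(P,f)$. An algorithm solves $T$ if in every run with $|Faulty(F)|\le f$ and initial values $\vec V$: every correct process eventually decides, decisions are irrevocable, no two processes decide differently, and decisions lie in $P(F,\vec V)$. $k\text{-TAg}_\Pi(F,\vec V)=\{0\}$ if at least $k$ entries of $\vec V$ are $0$; $=\{1\}$ if $\vec V$ is all-ones and $|Faulty(F)|\le k-1$; $=\{0,1\}$ otherwise; $k\text{-TAg}(\Pi,f)=(k\text{-TAg}_\Pi,f)$; $k\text{-TAg}(n,f)$ and $\mathrm{Cons}(n,f)=n\text{-TAg}(n,f)$ are the versions for $\Pi=\{1,\dots,n\}$. Oracles: for $T=(P,f)$ on $\Pi$, an $f$-resilient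 oracle suitable for $P$ is a black box with consultants $\Pi$ whose history (for failure pattern $F$) is a sequence of successive consultations, in each of which every consultant may submit at most one query in $\{0,1\}$ and the oracle returns a common response $d$ with $d\in P(F,\vec V)$ for every $\vec V$ extending the partial query vector (the oracle may use the whole failure pattern, including future crashes), and every correct querier gets the response whenever at least $|\Pi|-f$ consultants query. Such an oracle is consistent if for every $F$, every history $H$ of it under $F$, and any two consultations in $H$ with query vectors $\vec W_1,\vec W_2$ such that $\vec W_1$ extends $\vec W_2$ (as partial functions), the oracle answers $d$ in the consultation with $\vec W_2$ only if it answers $d$ in the consultation with $\vec W_1$. ${}^c\mathcal O.T$ denotes the most general consistent $f$-resilient oracle suitable for $P$. $T_1\le_{{}^cC}T_2$ means there is an algorithm solving $T_1$ whose processes may additionally consult the oracle ${}^c\mathcal O.T_2$. *)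

theory Defs
  imports Main
begin

datatype bit = B0 | B1

definition failure_pattern :: "'p set \<Rightarrow> (nat \<Rightarrow> 'p set) \<Rightarrow> bool" where
  "failure_pattern \<Pi> F \<longleftrightarrow> mono F \<and> (\<forall>t. F t \<subseteq> \<Pi>)"

definition Faulty :: "(nat \<Rightarrow> 'p set) \<Rightarrow> 'p set" where
  "Faulty F = (\<Union>t. F t)"

definition correct :: "'p set \<Rightarrow> (nat \<Rightarrow> 'p set) \<Rightarrow> 'p set" where
  "correct \<Pi> F = \<Pi> - Faulty F"

type_synonym 'p problem = "(nat \<Rightarrow> 'p set) \<Rightarrow> ('p \<Rightarrow> bit) \<Rightarrow> bit set"
type_synonym 'p task = "'p problem \<times> nat"

definition kTAg :: "nat \<Rightarrow> 'p set \<Rightarrow> 'p problem" where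
  "kTAg k \<Pi> F V =
     (if k \<le> card {p \<in> \<Pi>. V p = B0} then {B0}
      else if (\<forall>p \<in> \<Pi>. V p = B1) \<and> card (Faulty F) + 1 \<le> k then {B1}
      else {B0, B1})"

definition kTAg_task :: "nat \<Rightarrow> 'p set \<Rightarrow> nat \<Rightarrow> 'p task" where
  "kTAg_task k \<Pi> f = (kTAg k \<Pi>, f)"

definition Cons_task :: "nat \<Rightarrow> nat \<Rightarrow> nat task" where
  "Cons_task n f = kTAg_task n {1..n} f"

text \<open>Events a process may receive in a step: nothing, a message with content m
  from a sender q, or an oracle response.\<close>
datatype 'p event = Null | Msg 'p nat | Resp bit

text \<open>A step of process p in local state s upon event e yields the new state,
  the list of messages sent (destination, content), and possibly a query to the
  oracle.  The decision of p is read off its local state.\<close>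
record 'p algorithm =
  init :: "'p \<Rightarrow> bit \<Rightarrow> nat"
  trans :: "'p \<Rightarrow> nat \<Rightarrow> 'p event \<Rightarrow> nat \<times> ('p \<times> nat) list \<times> bit option"
  decision :: "'p \<Rightarrow> nat \<Rightarrow> bit option"

text \<open>Adversary choices of a run: the schedule (who steps at time t and which
  event it gets), the origin (send time, index) of each received message, the index
  of the oracle consultation open at time t, the response of each consultation, and
  the consultation to which each delivered response belongs.\<close>
record 'p schedule =
  sched :: "nat \<Rightarrow> ('p \<times> 'p event) option"
  msg_src :: "nat \<Rightarrow> nat \<times> nat"
  ocons :: "nat \<Rightarrow> nat"
  oresp :: "nat \<Rightarrow> bit"
  resp_cons :: "nat \<Rightarrow> nat"

primrec state :: "'p algorithm \<Rightarrow> ('p \<Rightarrow> bit) \<Rightarrow> 'p schedule \<Rightarrow> nat \<Rightarrow> 'p \<Rightarrow> nat" where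
  "state A V S 0 p = init A p (V p)"
| "state A V S (Suc t) p =
     (case sched S t of
        Some (q, e) \<Rightarrow> (if q = p then fst (trans A p (state A V S t p) e) else state A V S t p)
      | None \<Rightarrow> state A V S t p)"

definition sends_at :: "'p algorithm \<Rightarrow> ('p \<Rightarrow> bit) \<Rightarrow> 'p schedule \<Rightarrow> nat \<Rightarrow> ('p \<times> nat) list" where
  "sends_at A V S t =
     (case sched S t of Some (q, e) \<Rightarrow> fst (snd (trans A q (state A V S t q) e)) | None \<Rightarrow> [])"

definition qout :: "'p algorithm \<Rightarrow> ('p \<Rightarrow> bit) \<Rightarrow> 'p schedule \<Rightarrow> nat \<Rightarrow> 'p \<Rightarrow> bit option" where
  "qout A V S t p =
     (case sched S t of
        Some (q, e) \<Rightarrow> (if q = p then snd (snd (trans A p (state A V S t p) e)) else None)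
      | None \<Rightarrow> None)"

text \<open>Query vector of consultation c: a query issued at time t joins the consultation
  open at time t; only the first query of a process in a consultation counts.\<close>
definition Wq :: "'p algorithm \<Rightarrow> ('p \<Rightarrow> bit) \<Rightarrow> 'p schedule \<Rightarrow> nat \<Rightarrow> 'p \<Rightarrow> bit option" where
  "Wq A V S c p =
     (if \<exists>t. ocons S t = c \<and> qout A V S t p \<noteq> None
      then qout A V S (LEAST t. ocons S t = c \<and> qout A V S t p \<noteq> None) p
      else None)"

definition closed :: "'p schedule \<Rightarrow> nat \<Rightarrow> bool" where
  "closed S c \<longleftrightarrow> (\<exists>t. c < ocons S t)"

definition extends :: "'p set \<Rightarrow> ('p \<Rightarrow> bit) \<Rightarrow> ('p \<Rightarrow> bit option) \<Rightarrow> bool" where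
  "extends \<Pi> V W \<longleftrightarrow> (\<forall>p \<in> \<Pi>. \<forall>b. W p = Some b \<longrightarrow> V p = b)"

text \<open>Admissible runs of algorithm A on Pi, with failure pattern F and initial
  values V, in which processes may consult the most general consistent
  f2-resilient oracle suitable for P2.\<close>
definition is_run :: "'p algorithm \<Rightarrow> 'p set \<Rightarrow> 'p problem \<Rightarrow> nat \<Rightarrow> (nat \<Rightarrow> 'p set)
                      \<Rightarrow> ('p \<Rightarrow> bit) \<Rightarrow> 'p schedule \<Rightarrow> bool" where
  "is_run A \<Pi> P2 f2 F V S \<longleftrightarrow>
    (
     \<comment> \<open>only alive processes of Pi take steps\<close>
     (\<forall>t p e. sched S t = Some (p, e) \<longrightarrow> p \<in> \<Pi> \<and> p \<notin> F t) \<and>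
     \<comment> \<open>correct processes take infinitely many steps\<close>
     (\<forall>p \<in> correct \<Pi> F. \<forall>t. \<exists>t' \<ge> t. \<exists>e. sched S t' = Some (p, e)) \<and>
     \<comment> \<open>a received message was sent earlier to the receiver, with that content\<close>
     (\<forall>t p q m. sched S t = Some (p, Msg q m) \<longrightarrow>
        fst (msg_src S t) < t \<and> (\<exists>e. sched S (fst (msg_src S t)) = Some (q, e)) \<and>
        snd (msg_src S t) < length (sends_at A V S (fst (msg_src S t))) \<and>
        sends_at A V S (fst (msg_src S t)) ! snd (msg_src S t) = (p, m)) \<and>
     \<comment> \<open>no message is received twice\<close>
     (\<forall>t1 t2 p1 p2 q1 q2 m1 m2. sched S t1 = Some (p1, Msg q1 m1) \<longrightarrow>
        sched S t2 = Some (p2, Msg q2 m2) \<longrightarrow> t1 \<noteq> t2 \<longrightarrow> msg_src S t1 \<noteq> msg_src S t2) \<and>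
     \<comment> \<open>reliable channels: every message sent to a correct process is received\<close>
     (\<forall>t j. j < length (sends_at A V S t) \<longrightarrow> fst (sends_at A V S t ! j) \<in> correct \<Pi> F \<longrightarrow>
        (\<exists>t' q m. sched S t' = Some (fst (sends_at A V S t ! j), Msg q m) \<and> msg_src S t' = (t, j))) \<and>
     \<comment> \<open>successive consultations\<close>
     ocons S 0 = 0 \<and>
     (\<forall>t. ocons S (Suc t) = ocons S t \<or> ocons S (Suc t) = Suc (ocons S t)) \<and>
     \<comment> \<open>responses: only to queriers of a closed consultation, with its response\<close>
     (\<forall>t p d. sched S t = Some (p, Resp d) \<longrightarrow>
        resp_cons S t < ocons S t \<and> Wq A V S (resp_cons S t) p \<noteq> None \<and>
        d = oresp S (resp_cons S t)) \<and>
     \<comment> \<open>each response delivered at most once, in consultation order\<close>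
     (\<forall>t1 t2 p d1 d2. sched S t1 = Some (p, Resp d1) \<longrightarrow> sched S t2 = Some (p, Resp d2) \<longrightarrow>
        t1 < t2 \<longrightarrow> resp_cons S t1 < resp_cons S t2) \<and>
     \<comment> \<open>every correct querier of a closed consultation gets the response\<close>
     (\<forall>c p. closed S c \<longrightarrow> p \<in> correct \<Pi> F \<longrightarrow> Wq A V S c p \<noteq> None \<longrightarrow>
        (\<exists>t d. sched S t = Some (p, Resp d) \<and> resp_cons S t = c)) \<and>
     \<comment> \<open>f2-resilience: if at least |Pi| - f2 consultants query, the oracle responds\<close>
     (\<forall>c. card \<Pi> - f2 \<le> card {p \<in> \<Pi>. Wq A V S c p \<noteq> None} \<longrightarrow> closed S c) \<and>
     \<comment> \<open>suitability for P2\<close>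
     (\<forall>c V'. closed S c \<longrightarrow> extends \<Pi> V' (Wq A V S c) \<longrightarrow> oresp S c \<in> P2 F V') \<and>
     \<comment> \<open>consistency\<close>
     (\<forall>c1 c2. closed S c1 \<longrightarrow> closed S c2 \<longrightarrow>
        (\<forall>p b. Wq A V S c2 p = Some b \<longrightarrow> Wq A V S c1 p = Some b) \<longrightarrow>
        oresp S c2 = oresp S c1))"

definition solves :: "'p algorithm \<Rightarrow> 'p set \<Rightarrow> 'p task \<Rightarrow> 'p task \<Rightarrow> bool" where
  "solves A \<Pi> T T2 \<longleftrightarrow>
    (\<forall>F V S. failure_pattern \<Pi> F \<longrightarrow> card (Faulty F) \<le> snd T \<longrightarrow> is_run A \<Pi> (fst T2) (snd T2) F V S \<longrightarrow>
       (\<forall>p \<in> correct \<Pi> F. \<exists>t. decision A p (state A V S t p) \<noteq> None) \<and>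
       (\<forall>p \<in> \<Pi>. \<forall>t t' b. t \<le> t' \<longrightarrow> decision A p (state A V S t p) = Some b \<longrightarrow>
           decision A p (state A V S t' p) = Some b) \<and>
       (\<forall>p \<in> \<Pi>. \<forall>q \<in> \<Pi>. \<forall>t t' a b. decision A p (state A V S t p) = Some a \<longrightarrow>
           decision A q (state A V S t' q) = Some b \<longrightarrow> a = b) \<and>
       (\<forall>p \<in> \<Pi>. \<forall>t b. decision A p (state A V S t p) = Some b \<longrightarrow> b \<in> fst T F V))"

definition creduces :: "'p set \<Rightarrow> 'p task \<Rightarrow> 'p task \<Rightarrow> bool" where
  "creduces \<Pi> T1 T2 \<longleftrightarrow> (\<exists>A. solves A \<Pi> T1 T2)"

end

theory Submission
  imports Defs "HOL-Library.Countable"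
begin

text \<open>
  In round \<open>k\<close> every process broadcasts a value \<open>x\<^sub>k\<close>, waits for \<open>n - f\<close> round-\<open>k\<close> values
  and computes \<open>x\<^sub>k\<^sub>+\<^sub>1\<close> from them; any two such quorums meet since \<open>n > 2f\<close>.
  Rounds 0 and 1 turn the inputs into a graded value \<open>x\<^sub>2\<close>: if some process obtains the certain value
  0, then no process obtains the certain value 1. Each process then queries the oracle, with 0 only if
  \<open>x\<^sub>2\<close> is a certain 0, and takes the first answer as \<open>x\<^sub>3\<close>; after that it keeps querying 0,
  which forces later consultations to close. The estimate \<open>x\<^sub>4\<close> is 1 if a first answer 1
  was seen or the own \<open>x\<^sub>2\<close> is a certain 1, and 0 otherwise. From round 4 on, a deterministic
  version of Ben-Or's consensus algorithm runs on the estimates; it is always safe, and it terminates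
  in one phase if the estimates are unanimous.

  If fewer than \<open>f\<close> processes are faulty, the estimates are unanimous. An answer 1 needs more than
  \<open>n - f\<close> queries 1, so that every quorum sees a first answer 1; and if all first answers are 0, then
  some first query was 0, whence no \<open>x\<^sub>2\<close> is a certain 1. If exactly \<open>f\<close> processes are faulty, then after
  the last crash the only possible quorum is the set of all correct processes; these therefore compute
  equal values, and Ben-Or's algorithm terminates as well.
\<close>

section \<open>The algorithm\<close>

text \<open>States and message contents of the model are natural numbers, so structured ones are
  coded through countability.\<close>

instance bit :: countable
  by countable_datatype

datatype local_state = Local (input: bit) (hist: "bit option list")
  (rcvd: "(nat \<times> nat \<times> bit option) list") (answer: "bit option") (verdict: "bit option")

instance local_state :: countable
  by countable_datatype

definition unan :: "bit option set \<Rightarrow> bit option" where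
  "unan M = (if M = {Some B0} then Some B0 else if M = {Some B1} then Some B1 else None)"

text \<open>Even rounds from 4 on carry the estimates of Ben-Or's algorithm, odd rounds from 5 on its
  proposals, where \<^const>\<open>None\<close> stands for no proposal.\<close>

definition upd :: "nat \<Rightarrow> bit option \<Rightarrow> bit option \<Rightarrow> bit option set \<Rightarrow> bit option" where
  "upd k w b M =
     (if k = 0 then (if Some B0 \<in> M then Some B0 else Some B1)
      else if k = 1 then unan M
      else if k = 2 then b
      else if k = 3 then (if Some B1 \<in> M \<or> w = Some B1 then Some B1 else Some B0)
      else if even k then unan M
      else (if Some B1 \<in> M then Some B1 else Some B0))"

lemma unan_Some_iff: "unan M = Some v \<longleftrightarrow> M = {Some v}"
  by (cases v) (auto simp: unan_def)

text \<open>The state records every value broadcast so far: a process with \<^term>\<open>length (hist s) = Suc k\<close> has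
  sent its values of rounds \<open>0, \<dots>, k\<close> and is collecting those of round \<open>k\<close>.\<close>

definition heard :: "local_state \<Rightarrow> nat \<Rightarrow> nat set" where
  "heard s k = {i. \<exists>v. (i, k, v) \<in> set (rcvd s)}"

definition vals :: "local_state \<Rightarrow> nat \<Rightarrow> bit option set" where
  "vals s k = {v. \<exists>i. (i, k, v) \<in> set (rcvd s)}"

text \<open>\<open>hist s ! 2\<close> is unspecified on short lists; \<open>upd\<close> reads it
  only for \<open>k = 3\<close>, where the list has length 4.\<close>

definition next_value :: "local_state \<Rightarrow> bit option" where
  "next_value s = (case length (hist s) of
      0 \<Rightarrow> Some (input s)
    | Suc k \<Rightarrow> upd k (hist s ! 2) (answer s) (vals s k))"

definition next_verdict :: "local_state \<Rightarrow> bit option" where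
  "next_verdict s = (case length (hist s) of
      0 \<Rightarrow> verdict s
    | Suc k \<Rightarrow> if odd k \<and> 5 \<le> k \<and> verdict s = None then unan (vals s k) else verdict s)"

definition advance :: "local_state \<Rightarrow> local_state" where
  "advance s = Local (input s) (hist s @ [next_value s]) (rcvd s) (answer s) (next_verdict s)"

lemma advance_sel [simp]:
  "input (advance s) = input s" "hist (advance s) = hist s @ [next_value s]"
  "rcvd (advance s) = rcvd s" "answer (advance s) = answer s"
  "verdict (advance s) = next_verdict s"
  by (simp_all add: advance_def)

text \<open>States are numbers, so senders are stored through the injection \<open>idx\<close>;
  \<open>procs\<close> lists the destinations of a broadcast.\<close>

locale protocol =
  fixes \<Pi> :: "'p set" and f :: nat and idx :: "'p \<Rightarrow> nat" and procs :: "'p list"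
  assumes inj_idx: "inj_on idx \<Pi>" and set_procs: "set procs = \<Pi>"
    and f_pos: "1 \<le> f" and majority: "2 * f < card \<Pi>"
begin

definition absorb :: "local_state \<Rightarrow> 'p event \<Rightarrow> local_state" where
  "absorb s e = (case e of
      Null \<Rightarrow> s
    | Msg q m \<Rightarrow> Local (input s) (hist s) ((idx q, from_nat m) # rcvd s) (answer s) (verdict s)
    | Resp b \<Rightarrow> Local (input s) (hist s) (rcvd s)
        (if answer s = None then Some b else answer s) (verdict s))"

lemma absorb_sel [simp]:
  "input (absorb s e) = input s" "hist (absorb s e) = hist s" "verdict (absorb s e) = verdict s"
  by (simp_all add: absorb_def split: event.split)

definition ready :: "local_state \<Rightarrow> bool" where
  "ready s = (case length (hist s) of
      0 \<Rightarrow> True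
    | Suc k \<Rightarrow> if k = 2 then answer s \<noteq> None else card \<Pi> - f \<le> card (heard s k))"

definition after :: "local_state \<Rightarrow> 'p event \<Rightarrow> local_state" where
  "after s e = (if ready (absorb s e) then advance (absorb s e) else absorb s e)"

definition outbox :: "local_state \<Rightarrow> 'p event \<Rightarrow> ('p \<times> nat) list" where
  "outbox s e = (if ready (absorb s e)
     then map (\<lambda>q. (q, to_nat (length (hist s), next_value (absorb s e)))) procs else [])"

text \<open>An answered process queries \<open>B0\<close> at every step, which supplies the queries
  that close later consultations. The test \<open>length (hist s) = 2\<close> singles out the step
  that broadcasts the round-2 value; an uncertain value is queried as \<open>B1\<close>.\<close>

definition query :: "local_state \<Rightarrow> 'p event \<Rightarrow> bit option" where
  "query s e = (if answer (absorb s e) \<noteq> None then Some B0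
     else if ready (absorb s e) \<and> length (hist s) = 2
       then Some (if next_value (absorb s e) = Some B0 then B0 else B1)
     else None)"

definition alg :: "'p algorithm" where
  "alg = \<lparr>init = \<lambda>p v. to_nat (Local v [] [] None None),
     trans = \<lambda>p s e. (to_nat (after (from_nat s) e), outbox (from_nat s) e, query (from_nat s) e),
     decision = \<lambda>p s. verdict (from_nat s)\<rparr>"

lemma finite_Pi: "finite \<Pi>"
  using set_procs by (metis List.finite_set)

lemma quorums_meet:
  assumes "Q \<subseteq> \<Pi>" "Q' \<subseteq> \<Pi>" "card \<Pi> - f \<le> card Q" "card \<Pi> - f \<le> card Q'"
  shows "Q \<inter> Q' \<noteq> {}"
proof
  assume "Q \<inter> Q' = {}"
  then have "card (Q \<union> Q') = card Q + card Q'"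
    using assms finite_Pi by (meson card_Un_disjoint finite_subset)
  moreover have "card (Q \<union> Q') \<le> card \<Pi>"
    using assms finite_Pi by (simp add: card_mono)
  ultimately show False using assms majority by linarith
qed

lemma quorum_nonempty: "card \<Pi> - f \<le> card Q \<Longrightarrow> Q \<noteq> {}"
  using majority by auto

end

section \<open>Runs of the algorithm\<close>

locale protocol_run = protocol \<Pi> f idx procs
  for \<Pi> :: "'p set" and f :: nat and idx :: "'p \<Rightarrow> nat" and procs :: "'p list" +
  fixes F :: "nat \<Rightarrow> 'p set" and V :: "'p \<Rightarrow> bit" and S :: "'p schedule"
  assumes pattern: "failure_pattern \<Pi> F" and resilience: "card (Faulty F) \<le> f"
    and run: "is_run alg \<Pi> (kTAg f \<Pi>) f F V S"
begin

lemmas run_conj = run[unfolded is_run_def]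
  and run_tl1 = run[unfolded is_run_def, THEN conjunct2]
lemmas run_tl2 = run_tl1[THEN conjunct2]
lemmas run_tl3 = run_tl2[THEN conjunct2]
lemmas run_tl4 = run_tl3[THEN conjunct2]
lemmas run_tl6 = run_tl4[THEN conjunct2, THEN conjunct2]
lemmas run_tl7 = run_tl6[THEN conjunct2]
lemmas run_tl9 = run_tl7[THEN conjunct2, THEN conjunct2]
lemmas run_tl10 = run_tl9[THEN conjunct2]
lemmas run_tl11 = run_tl10[THEN conjunct2]

lemma run_sched: "sched S t = Some (p, e) \<Longrightarrow> p \<in> \<Pi> \<and> p \<notin> F t"
  using run_conj[THEN conjunct1] by blast

lemma run_fair: "p \<in> correct \<Pi> F \<Longrightarrow> \<exists>t' \<ge> t. \<exists>e. sched S t' = Some (p, e)"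
  using run_tl1[THEN conjunct1] by blast

lemma run_received:
  assumes "sched S t = Some (p, Msg q m)" and "msg_src S t = (t0, j)"
  shows "\<exists>e. sched S t0 = Some (q, e)" "j < length (sends_at alg V S t0)"
    "sends_at alg V S t0 ! j = (p, m)"
  using run_tl2[THEN conjunct1, rule_format, OF assms(1)] assms(2) by simp_all

lemma run_reliable:
  assumes "j < length (sends_at alg V S t)" and "sends_at alg V S t ! j = (p, m)"
    and "p \<in> correct \<Pi> F"
  shows "\<exists>t' q. sched S t' = Some (p, Msg q m) \<and> msg_src S t' = (t, j)"
proof -
  obtain t' q m' where *: "sched S t' = Some (p, Msg q m')" "msg_src S t' = (t, j)"
    using run_tl4[THEN conjunct1, rule_format, OF assms(1)] assms(2,3) by auto
  then show ?thesis using run_received(3)[OF *] assms(2) by auto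
qed

lemma run_ocons: "ocons S (Suc t) = ocons S t \<or> ocons S (Suc t) = Suc (ocons S t)"
  using run_tl6[THEN conjunct1] by blast

lemma run_resp:
  "sched S t = Some (p, Resp d) \<Longrightarrow> \<exists>c < ocons S t. Wq alg V S c p \<noteq> None \<and> d = oresp S c"
  using run_tl7[THEN conjunct1] by blast

lemma run_answered:
  "closed S c \<Longrightarrow> p \<in> correct \<Pi> F \<Longrightarrow> Wq alg V S c p \<noteq> None \<Longrightarrow> \<exists>t d. sched S t = Some (p, Resp d)"
  using run_tl9[THEN conjunct1] by blast

lemma run_closed: "card \<Pi> - f \<le> card {p \<in> \<Pi>. Wq alg V S c p \<noteq> None} \<Longrightarrow> closed S c"
  using run_tl10[THEN conjunct1] by blast

lemma run_suitable: "closed S c \<Longrightarrow> extends \<Pi> V' (Wq alg V S c) \<Longrightarrow> oresp S c \<in> kTAg f \<Pi> F V'"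
  using run_tl11[THEN conjunct1] by blast

lemma ocons_mono: "t \<le> t' \<Longrightarrow> ocons S t \<le> ocons S t'"
proof (induction t' rule: dec_induct)
  case (step m)
  then show ?case using run_ocons[of m] by linarith
qed simp

section \<open>Growth of local states along a run\<close>

definition st :: "nat \<Rightarrow> 'p \<Rightarrow> local_state" where
  "st t p = from_nat (state alg V S t p)"

lemma st_0: "st 0 p = Local (V p) [] [] None None"
  by (simp add: st_def alg_def)

lemma st_step: "sched S t = Some (p, e) \<Longrightarrow> st (Suc t) p = after (st t p) e"
  by (simp add: st_def alg_def)

lemma st_idle: "(\<And>e. sched S t \<noteq> Some (p, e)) \<Longrightarrow> st (Suc t) p = st t p"
  by (auto simp add: st_def split: option.split)

lemma sends_at_step: "sched S t = Some (p, e) \<Longrightarrow> sends_at alg V S t = outbox (st t p) e"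
  by (simp add: st_def alg_def sends_at_def)

lemma qout_eq_Some_iff:
  "qout alg V S t p = Some b \<longleftrightarrow> (\<exists>e. sched S t = Some (p, e) \<and> query (st t p) e = Some b)"
  by (auto simp add: st_def alg_def qout_def split: option.split)

lemma st_induct [case_names init step]:
  assumes "P (Local (V p) [] [] None None)"
    and "\<And>t e. sched S t = Some (p, e) \<Longrightarrow> P (st t p) \<Longrightarrow> P (after (st t p) e)"
  shows "P (st t p)"
proof (induction t)
  case (Suc t)
  then show ?case
    by (cases "\<exists>e. sched S t = Some (p, e)") (auto simp: st_step st_idle assms)
qed (simp add: st_0 assms)

lemma st_mono:
  assumes "t \<le> t'" and "\<And>s. R s s" and "\<And>s e s'. R s s' \<Longrightarrow> R s (after s' e)"
  shows "R (st t p) (st t' p)"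
  using assms(1)
proof (induction t' rule: dec_induct)
  case (step m)
  then show ?case
    by (cases "\<exists>e. sched S m = Some (p, e)") (auto simp: st_step st_idle assms)
qed (rule assms(2))

lemma hist_mono: "t \<le> t' \<Longrightarrow> \<exists>ys. hist (st t' p) = hist (st t p) @ ys"
  by (rule st_mono) (auto simp: after_def)

lemma rcvd_mono: "t \<le> t' \<Longrightarrow> set (rcvd (st t p)) \<subseteq> set (rcvd (st t' p))"
  by (rule st_mono) (auto simp: after_def absorb_def split: event.split)

lemma answer_mono: "t \<le> t' \<Longrightarrow> answer (st t p) = Some b \<longrightarrow> answer (st t' p) = Some b"
  by (rule st_mono) (auto simp: after_def absorb_def split: event.split)

lemma verdict_mono: "t \<le> t' \<Longrightarrow> verdict (st t p) = Some b \<longrightarrow> verdict (st t' p) = Some b"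
  by (rule st_mono) (auto simp: after_def next_verdict_def split: nat.split)

lemma length_hist_mono: "t \<le> t' \<Longrightarrow> length (hist (st t p)) \<le> length (hist (st t' p))"
  using hist_mono[of t t' p] by auto

text \<open>The value \<open>x p k\<close> broadcast by \<open>p\<close> in round \<open>k\<close> is meaningful only if \<open>reached p k\<close>.\<close>

definition reached :: "'p \<Rightarrow> nat \<Rightarrow> bool" where
  "reached p k \<longleftrightarrow> (\<exists>t. k < length (hist (st t p)))"

definition x :: "'p \<Rightarrow> nat \<Rightarrow> bit option" where
  "x p k = hist (st (LEAST t. k < length (hist (st t p))) p) ! k"

lemma hist_nth:
  assumes "k < length (hist (st t p))"
  shows "hist (st t p) ! k = x p k"
proof -
  let ?T = "LEAST t. k < length (hist (st t p))"
  have "?T \<le> t" "k < length (hist (st ?T p))"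
    using assms by (auto intro: Least_le LeastI)
  then show ?thesis
    using hist_mono[of ?T t p] by (auto simp: x_def nth_append)
qed

definition enters :: "'p \<Rightarrow> nat \<Rightarrow> nat \<Rightarrow> 'p event \<Rightarrow> bool" where
  "enters p k t e \<longleftrightarrow> sched S t = Some (p, e) \<and> ready (absorb (st t p) e) \<and> length (hist (st t p)) = k"

lemma entersD:
  assumes "enters p k t e"
  shows "st (Suc t) p = advance (absorb (st t p) e)" "reached p k"
    "x p k = next_value (absorb (st t p) e)" "p \<in> \<Pi>"
proof -
  show *: "st (Suc t) p = advance (absorb (st t p) e)"
    using assms by (simp add: enters_def st_step after_def)
  then have "k < length (hist (st (Suc t) p))"
    using assms by (simp add: enters_def)
  then show "reached p k" "x p k = next_value (absorb (st t p) e)"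
    using hist_nth[of k "Suc t" p] assms * unfolding reached_def by (blast, auto simp: enters_def)
  show "p \<in> \<Pi>" using assms run_sched by (auto simp: enters_def)
qed

text \<open>Each step appends at most one value, so just before the least time with more than
  \<open>k\<close> values there are exactly \<open>k\<close>.\<close>

lemma reached_enters:
  assumes "reached p k"
  shows "\<exists>t e. enters p k t e"
proof -
  let ?T = "LEAST t. k < length (hist (st t p))"
  have T: "k < length (hist (st ?T p))"
    using assms unfolding reached_def by (auto intro: LeastI)
  then obtain t where t: "?T = Suc t"
    by (cases ?T) (auto simp: st_0)
  then have nt: "\<not> k < length (hist (st t p))"
    using not_less_Least[of t "\<lambda>t. k < length (hist (st t p))"] by auto
  with T t obtain e where e: "sched S t = Some (p, e)"
    by (metis st_idle)
  then have "ready (absorb (st t p) e)" "length (hist (st t p)) = k"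
    using T t nt by (auto simp: st_step after_def split: if_splits)
  with e show ?thesis by (auto simp: enters_def)
qed

lemma enters_unique:
  assumes "enters p k t e" "enters p k t' e'"
  shows "t = t'"
proof -
  have "\<not> t < t'" if "enters p k t e" "enters p k t' e'" for t t' e e'
    using that length_hist_mono[of "Suc t" t' p] entersD(1)[OF that(1)] by (auto simp: enters_def)
  then show ?thesis using assms by (metis linorder_neqE_nat)
qed

lemma reached_Pi: "reached p k \<Longrightarrow> p \<in> \<Pi>"
  using reached_enters entersD(4) by blast

lemma reached_le: "reached p k \<Longrightarrow> j \<le> k \<Longrightarrow> reached p j"
  unfolding reached_def by (meson le_less_trans)

text \<open>Messages are genuine: a newly stored triple is traced through \<open>msg_src\<close> to
  the step in which its sender entered round \<open>k\<close>.\<close>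

lemma rcvd_sound:
  "(i, k, v) \<in> set (rcvd (st t p)) \<Longrightarrow> \<exists>q. i = idx q \<and> reached q k \<and> v = x q k"
proof (induction t)
  case (Suc t)
  show ?case
  proof (cases "(i, k, v) \<in> set (rcvd (st t p))")
    case False
    with Suc.prems obtain e where e: "sched S t = Some (p, e)" by (metis st_idle)
    with Suc.prems False have "(i, k, v) \<in> set (rcvd (absorb (st t p) e))"
      by (auto simp: st_step after_def split: if_splits)
    with False obtain q m where qm: "e = Msg q m" "i = idx q" "from_nat m = (k, v)"
      by (auto simp: absorb_def split: event.splits)
    obtain t0 j where "msg_src S t = (t0, j)" by fastforce
    from run_received[OF e[unfolded qm(1)] this] obtain e0 where
      s: "sched S t0 = Some (q, e0)" "j < length (outbox (st t0 q) e0)" "outbox (st t0 q) e0 ! j = (p, m)"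
      using sends_at_step by auto
    then have r: "ready (absorb (st t0 q) e0)" by (auto simp: outbox_def split: if_splits)
    with s have "m = to_nat (length (hist (st t0 q)), next_value (absorb (st t0 q) e0))"
      by (auto simp: outbox_def)
    with qm have kv: "k = length (hist (st t0 q))" "v = next_value (absorb (st t0 q) e0)"
      by auto
    then have "enters q k t0 e0" using s r by (simp add: enters_def)
    then show ?thesis using entersD(2,3)[of q k t0 e0] kv(2) qm(2) by auto
  qed (use Suc.IH in blast)
qed (simp add: st_0)

lemma x_0: "reached p 0 \<Longrightarrow> x p 0 = Some (V p)"
proof -
  assume "reached p 0"
  then obtain t e where "enters p 0 t e" using reached_enters by blast
  moreover have "input (st t p) = V p"
    by (induction rule: st_induct) (auto simp: after_def)
  ultimately show ?thesis using entersD(3)[of p 0 t e] by (auto simp: enters_def next_value_def)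
qed

lemma after_rcvd: "rcvd (after s e) = rcvd (absorb s e)"
  by (simp add: after_def)

text \<open>\<open>ready\<close> counts sender codes; soundness of \<open>rcvd\<close> and
  injectivity of \<open>idx\<close> turn them into processes with one value each. Leaving round 2
  depends on the oracle instead, hence \<open>k \<noteq> 2\<close>.\<close>

lemma enters_quorum:
  assumes "enters p (Suc k) t e" and "k \<noteq> 2"
  shows "\<exists>Q \<subseteq> \<Pi>. card \<Pi> - f \<le> card Q \<and> (\<forall>q \<in> Q. reached q k) \<and>
    vals (absorb (st t p) e) k = (\<lambda>q. x q k) ` Q"
proof -
  let ?s = "absorb (st t p) e"
  let ?Q = "{q \<in> \<Pi>. reached q k \<and> idx q \<in> heard ?s k}"
  have sound: "\<exists>q. i = idx q \<and> reached q k \<and> v = x q k" if "(i, k, v) \<in> set (rcvd ?s)" for i v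
    using that rcvd_sound[of i k v "Suc t" p] entersD(1)[OF assms(1)] by simp
  have "heard ?s k \<subseteq> idx ` ?Q"
  proof
    fix i assume i: "i \<in> heard ?s k"
    then obtain q where "i = idx q" "reached q k" using sound unfolding heard_def by blast
    with i show "i \<in> idx ` ?Q" using reached_Pi by blast
  qed
  then have "card (heard ?s k) \<le> card (idx ` ?Q)"
    by (rule card_mono[rotated]) (simp add: finite_Pi)
  also have "\<dots> \<le> card ?Q"
    by (rule card_image_le) (simp add: finite_Pi)
  finally have "card (heard ?s k) \<le> card ?Q" .
  moreover have "card \<Pi> - f \<le> card (heard ?s k)"
    using assms by (auto simp: enters_def ready_def)
  moreover have "vals ?s k = (\<lambda>q. x q k) ` ?Q"
  proof
    show "vals ?s k \<subseteq> (\<lambda>q. x q k) ` ?Q"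
    proof
      fix v assume "v \<in> vals ?s k"
      then obtain i where i: "(i, k, v) \<in> set (rcvd ?s)" by (auto simp: vals_def)
      then obtain q where "i = idx q" "reached q k" "v = x q k" using sound by blast
      moreover from this i have "idx q \<in> heard ?s k" unfolding heard_def by auto
      ultimately show "v \<in> (\<lambda>q. x q k) ` ?Q" using reached_Pi by blast
    qed
    show "(\<lambda>q. x q k) ` ?Q \<subseteq> vals ?s k"
    proof
      fix v assume "v \<in> (\<lambda>q. x q k) ` ?Q"
      then obtain q where q: "q \<in> \<Pi>" "v = x q k" "idx q \<in> heard ?s k" by blast
      then obtain w where w: "(idx q, k, w) \<in> set (rcvd ?s)" by (auto simp: heard_def)
      then obtain q' where "idx q = idx q'" "reached q' k" "w = x q' k" using sound by blast
      then have "w = v" using q inj_idx reached_Pi by (metis inj_onD)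
      then show "v \<in> vals ?s k" using w by (auto simp: vals_def)
    qed
  qed
  ultimately show ?thesis by (intro exI[of _ ?Q]) auto
qed

lemma reached_quorum:
  assumes "reached p (Suc k)" "k \<noteq> 2"
  shows "\<exists>Q b. Q \<subseteq> \<Pi> \<and> card \<Pi> - f \<le> card Q \<and> (\<forall>q \<in> Q. reached q k) \<and>
    x p (Suc k) = upd k (x p 2) b ((\<lambda>q. x q k) ` Q) \<and>
    (odd k \<longrightarrow> 5 \<le> k \<longrightarrow> unan ((\<lambda>q. x q k) ` Q) \<noteq> None \<longrightarrow> (\<exists>t. verdict (st t p) \<noteq> None))"
proof -
  obtain t e where te: "enters p (Suc k) t e" using assms(1) reached_enters by blast
  let ?s = "absorb (st t p) e"
  obtain Q where Q: "Q \<subseteq> \<Pi>" "card \<Pi> - f \<le> card Q" "\<forall>q \<in> Q. reached q k"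
    "vals ?s k = (\<lambda>q. x q k) ` Q"
    using enters_quorum[OF te assms(2)] by blast
  have len: "length (hist (st t p)) = Suc k" using te by (simp add: enters_def)
  have "x p (Suc k) = upd k (hist (st t p) ! 2) (answer ?s) (vals ?s k)"
    using entersD(3)[OF te] len by (simp add: next_value_def)
  also have "\<dots> = upd k (x p 2) (answer ?s) (vals ?s k)"
  proof (cases "k = 3")
    case True
    then show ?thesis using len hist_nth[of 2 t p] by simp
  qed (simp add: upd_def)
  finally have u: "x p (Suc k) = upd k (x p 2) (answer ?s) ((\<lambda>q. x q k) ` Q)"
    using Q by simp
  have "verdict (st (Suc t) p) \<noteq> None" if "odd k" "5 \<le> k" "unan ((\<lambda>q. x q k) ` Q) \<noteq> None"
    using that Q(4) len entersD(1)[OF te] by (simp add: next_verdict_def)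
  with u Q show ?thesis by metis
qed

lemma verdict_quorum:
  "verdict (st t p) = Some v \<Longrightarrow>
    \<exists>k Q. odd k \<and> 5 \<le> k \<and> Q \<subseteq> \<Pi> \<and> card \<Pi> - f \<le> card Q \<and> (\<forall>q \<in> Q. reached q k \<and> x q k = Some v)"
proof (induction t)
  case (Suc t)
  show ?case
  proof (cases "verdict (st t p) = Some v")
    case False
    with Suc.prems obtain e where e: "sched S t = Some (p, e)" by (metis st_idle)
    let ?s = "absorb (st t p) e"
    from Suc.prems False e have r: "ready ?s" "next_verdict ?s = Some v"
      by (auto simp: st_step after_def split: if_splits)
    with False obtain k where k: "length (hist (st t p)) = Suc k" "odd k" "5 \<le> k"
      "vals ?s k = {Some v}"
      by (auto simp: next_verdict_def unan_Some_iff split: nat.splits if_splits)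
    then have "enters p (Suc k) t e" using e r by (simp add: enters_def)
    from enters_quorum[OF this] k show ?thesis by fastforce
  qed (use Suc.IH in blast)
qed (simp add: st_0)

section \<open>Queries and answers\<close>

lemma Wq_qout:
  assumes "Wq alg V S c p = Some b"
  shows "\<exists>t. ocons S t = c \<and> qout alg V S t p = Some b"
proof -
  let ?P = "\<lambda>t. ocons S t = c \<and> qout alg V S t p \<noteq> None"
  have ex: "\<exists>t. ?P t" using assms unfolding Wq_def by (meson option.distinct(1))
  then have "?P (LEAST t. ?P t)" by (rule LeastI_ex)
  moreover have "qout alg V S (LEAST t. ?P t) p = Some b"
    using assms ex unfolding Wq_def by simp
  ultimately show ?thesis by blast
qed

lemma qout_Wq:
  assumes "qout alg V S t p \<noteq> None"
  shows "Wq alg V S (ocons S t) p \<noteq> None"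
proof -
  let ?P = "\<lambda>t'. ocons S t' = ocons S t \<and> qout alg V S t' p \<noteq> None"
  have "?P (LEAST t'. ?P t')" using assms by (intro LeastI[of ?P t]) simp
  then show ?thesis using assms unfolding Wq_def by auto
qed

lemma query_cases:
  assumes "sched S t = Some (p, e)" "query (st t p) e = Some b"
  shows "enters p 2 t e \<and> b = (if x p 2 = Some B0 then B0 else B1) \<or>
    b = B0 \<and> answer (st (Suc t) p) \<noteq> None"
proof (cases "answer (absorb (st t p) e) = None")
  case True
  with assms have "enters p 2 t e" "b = (if next_value (absorb (st t p) e) = Some B0 then B0 else B1)"
    by (auto simp: query_def enters_def split: if_splits)
  then show ?thesis using entersD(3) by metis
next
  case False
  with assms show ?thesis by (auto simp: query_def st_step after_def)
qed

lemma enters_query: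
  assumes "enters p 2 t e"
  shows "Wq alg V S (ocons S t) p \<noteq> None"
proof (rule qout_Wq)
  have "query (st t p) e \<noteq> None" using assms by (simp add: enters_def query_def)
  then show "qout alg V S t p \<noteq> None"
    using assms qout_eq_Some_iff[of t p] by (auto simp: enters_def)
qed

lemma answer_first:
  "answer (st t p) = Some b \<Longrightarrow>
    \<exists>t' < t. sched S t' = Some (p, Resp b) \<and> answer (st t' p) = None"
proof (induction t)
  case (Suc t)
  show ?case
  proof (cases "answer (st t p) = Some b")
    case True
    then show ?thesis using Suc.IH less_SucI by blast
  next
    case False
    with Suc.prems obtain e where e: "sched S t = Some (p, e)" by (metis st_idle)
    then have "answer (absorb (st t p) e) = Some b"
      using Suc.prems by (auto simp: st_step after_def split: if_splits)
    with False have "e = Resp b" "answer (st t p) = None"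
      by (auto simp: absorb_def split: event.splits if_splits)
    with e show ?thesis by blast
  qed
qed (simp add: st_0)

text \<open>Only closed consultations respond, so the query precedes the response. The process had
  no answer at that query either, and such a query can only be the one made on entering round
  2.\<close>

lemma first_response:
  assumes "sched S t = Some (p, Resp d)" "answer (st t p) = None"
  shows "\<exists>t0 e0. enters p 2 t0 e0 \<and> t0 < t \<and> ocons S t0 < ocons S t \<and> d = oresp S (ocons S t0)"
proof -
  obtain c where c: "c < ocons S t" "Wq alg V S c p \<noteq> None" "d = oresp S c"
    using run_resp[OF assms(1)] by blast
  then obtain b t0 where t0: "ocons S t0 = c" "qout alg V S t0 p = Some b"
    using Wq_qout by blast
  then obtain e0 where e0: "sched S t0 = Some (p, e0)" "query (st t0 p) e0 = Some b"
    using qout_eq_Some_iff by blast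
  have "t0 < t"
    using c t0 ocons_mono[of t t0] by (meson leD leI)
  then have "answer (st (Suc t0) p) = None"
    using answer_mono[of "Suc t0" t p] assms(2) by (cases "answer (st (Suc t0) p)") auto
  then have "enters p 2 t0 e0"
    using query_cases[OF e0] by auto
  with \<open>t0 < t\<close> t0 c show ?thesis by blast
qed

lemma answered:
  assumes "answer (st t p) = Some b"
  shows "\<exists>t0 e0. enters p 2 t0 e0 \<and> ocons S t0 < ocons S t \<and> b = oresp S (ocons S t0)"
    and "reached p 3"
proof -
  obtain t1 where t1: "t1 < t" "sched S t1 = Some (p, Resp b)" "answer (st t1 p) = None"
    using answer_first[OF assms] by blast
  then obtain t0 e0 where t0: "enters p 2 t0 e0" "t0 < t1" "ocons S t0 < ocons S t1"
      "b = oresp S (ocons S t0)"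
    using first_response by blast
  then show "\<exists>t0 e0. enters p 2 t0 e0 \<and> ocons S t0 < ocons S t \<and> b = oresp S (ocons S t0)"
    using ocons_mono[of t1 t] t1(1) by (intro exI[of _ t0] exI[of _ e0]) auto
  have "3 \<le> length (hist (st t1 p))"
    using length_hist_mono[of "Suc t0" t1 p] t0(2) entersD(1)[OF t0(1)] t0(1)
    by (simp add: enters_def)
  moreover have "reached p 3" if "length (hist (st t1 p)) = 3"
  proof -
    \<comment> \<open>\<open>ready\<close> is tested after \<open>absorb\<close>, so the step that
      receives the first response also enters round 3.\<close>
    have "answer (absorb (st t1 p) (Resp b)) \<noteq> None" by (simp add: absorb_def)
    then have "enters p 3 t1 (Resp b)"
      using that t1(2) by (simp add: enters_def ready_def numeral_3_eq_3 numeral_2_eq_2)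
    then show ?thesis by (rule entersD)
  qed
  ultimately show "reached p 3"
    unfolding reached_def by (metis le_neq_implies_less)
qed

lemma x_3:
  assumes "reached p 3"
  shows "\<exists>t e. enters p 2 t e \<and> closed S (ocons S t) \<and> x p 3 = Some (oresp S (ocons S t))"
proof -
  obtain t e where te: "enters p 3 t e" using assms reached_enters by blast
  let ?s = "absorb (st t p) e"
  have len: "length (hist (st t p)) = Suc 2" "ready ?s" using te by (auto simp: enters_def)
  then obtain b where b: "answer ?s = Some b" by (auto simp: ready_def)
  have "x p 3 = answer ?s"
    using entersD(3)[OF te] len by (simp add: next_value_def upd_def)
  moreover have "answer (st (Suc t) p) = Some b"
    using entersD(1)[OF te] b by simp
  ultimately show ?thesis
    using answered(1)[of "Suc t" p b] b unfolding closed_def by auto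
qed

text \<open>Queries after an answer are \<open>B0\<close>, so a query \<open>B1\<close> is the first
  query of its issuer.\<close>

lemma Wq_B1:
  assumes "Wq alg V S c p = Some B1"
  shows "\<exists>t e. enters p 2 t e \<and> ocons S t = c" "x p 2 \<noteq> Some B0"
proof -
  obtain t e where "ocons S t = c" "sched S t = Some (p, e)" "query (st t p) e = Some B1"
    using Wq_qout[OF assms] qout_eq_Some_iff by blast
  with query_cases[of t p e B1]
  show "\<exists>t e. enters p 2 t e \<and> ocons S t = c" "x p 2 \<noteq> Some B0" by auto
qed

text \<open>In the second case the first query lies in a strictly earlier consultation, which drives
  the descent in \<open>x_3_B0_cause\<close>.\<close>

lemma Wq_B0:
  assumes "Wq alg V S c p = Some B0"
  shows "reached p 2 \<and> x p 2 = Some B0 \<or>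
    reached p 3 \<and> (\<exists>t e. enters p 2 t e \<and> ocons S t < c)"
proof -
  obtain t e where t: "ocons S t = c" "sched S t = Some (p, e)" "query (st t p) e = Some B0"
    using Wq_qout[OF assms] qout_eq_Some_iff by blast
  consider "enters p 2 t e" "x p 2 = Some B0" | b where "answer (st (Suc t) p) = Some b"
    using query_cases[OF t(2,3)] by (auto split: if_splits)
  then show ?thesis
  proof cases
    case 1
    then show ?thesis using entersD by blast
  next
    case 2
    obtain t1 where t1: "t1 < Suc t" "sched S t1 = Some (p, Resp b)" "answer (st t1 p) = None"
      using answer_first[OF 2] by blast
    obtain t0 e0 where "enters p 2 t0 e0" "ocons S t0 < ocons S t1"
      using first_response[OF t1(2,3)] by blast
    moreover have "ocons S t1 \<le> c" using ocons_mono[of t1 t] t1(1) t(1) by simp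
    ultimately show ?thesis using answered(2)[OF 2] by (meson less_le_trans)
  qed
qed

text \<open>The answer must suit the completion with the most zeros; \<open>f\<close> zeros would
  force \<open>B0\<close>, so fewer than \<open>f\<close> processes fail to query
  \<open>B1\<close>.\<close>

lemma oresp_B1:
  assumes "closed S c" "oresp S c = B1"
  shows "card \<Pi> - f < card {p \<in> \<Pi>. Wq alg V S c p = Some B1}" (is "_ < card ?A")
proof -
  \<comment> \<open>all missing queries are completed by \<^const>\<open>B0\<close>\<close>
  define V' where "V' p = (case Wq alg V S c p of Some b \<Rightarrow> b | None \<Rightarrow> B0)" for p
  have "extends \<Pi> V' (Wq alg V S c)" by (simp add: extends_def V'_def)
  then have "B1 \<in> kTAg f \<Pi> F V'" using run_suitable[OF assms(1)] assms(2) by auto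
  then have "card {p \<in> \<Pi>. V' p = B0} < f" by (auto simp: kTAg_def split: if_splits)
  moreover have "{p \<in> \<Pi>. V' p = B0} = \<Pi> - ?A"
  proof -
    have "V' p = B0 \<longleftrightarrow> Wq alg V S c p \<noteq> Some B1" for p
      using bit.exhaust by (auto simp: V'_def split: option.split)
    then show ?thesis by auto
  qed
  moreover have "card (\<Pi> - ?A) = card \<Pi> - card ?A"
    using finite_Pi by (simp add: card_Diff_subset)
  ultimately have "card \<Pi> - card ?A < f" by simp
  then show ?thesis using majority by linarith
qed

text \<open>Without a query \<open>B0\<close> the all-ones vector extends the queries, and fewer
  than \<open>f\<close> faults then force the answer \<open>B1\<close>.\<close>

lemma oresp_B0:
  assumes "closed S c" "oresp S c = B0" "card (Faulty F) < f"
  shows "\<exists>p. Wq alg V S c p = Some B0"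
proof (rule ccontr)
  assume "\<not> ?thesis"
  then have "extends \<Pi> (\<lambda>_. B1) (Wq alg V S c)"
    unfolding extends_def by (metis bit.exhaust)
  then have "B0 \<in> kTAg f \<Pi> F (\<lambda>_. B1)" using run_suitable[OF assms(1)] assms(2) by metis
  \<comment> \<open>\<open>f_pos\<close> excludes the case of at least \<open>f\<close> zeros, since
    the all-ones vector has none.\<close>
  then show False using assms(3) f_pos by (simp add: kTAg_def)
qed

text \<open>A consultation answered \<^const>\<open>B1\<close> has more than \<^term>\<open>card \<Pi> - f\<close> queries \<^const>\<open>B1\<close>,
  and these are first queries of their issuers, whose first answers are therefore all \<^const>\<open>B1\<close>.\<close>

lemma quorum_sees_B1:
  assumes "reached q 3" "x q 3 = Some B1"
    and "Q \<subseteq> \<Pi>" "card \<Pi> - f \<le> card Q" "\<forall>p \<in> Q. reached p 3"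
  shows "\<exists>p \<in> Q. x p 3 = Some B1"
proof -
  obtain c where c: "closed S c" "oresp S c = B1" using x_3[OF assms(1)] assms(2) by auto
  let ?A = "{p \<in> \<Pi>. Wq alg V S c p = Some B1}"
  have "?A \<inter> Q \<noteq> {}"
    using oresp_B1[OF c] assms by (intro quorums_meet) auto
  then obtain p where p: "p \<in> Q" "Wq alg V S c p = Some B1" by auto
  obtain t e where "enters p 2 t e" "ocons S t = c" using Wq_B1(1)[OF p(2)] by blast
  moreover obtain t' e' where "enters p 2 t' e'" "x p 3 = Some (oresp S (ocons S t'))"
    using x_3 assms(5) p(1) by blast
  ultimately have "x p 3 = Some B1" using enters_unique[of p 2 t e t' e'] c(2) by simp
  with p show ?thesis by blast
qed

text \<open>Induction on the consultation: a query \<^const>\<open>B0\<close> that is not a first query follows an answer to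
  an earlier first query.\<close>

lemma x_3_B0_cause:
  assumes "card (Faulty F) < f" and "reached p 3"
    and all0: "\<And>q. reached q 3 \<Longrightarrow> x q 3 = Some B0"
  shows "\<exists>q. reached q 2 \<and> x q 2 = Some B0"
proof (rule ccontr)
  assume no: "\<not> ?thesis"
  have "False" if "reached p 3" "enters p 2 t e" "ocons S t = c" for p t e c
    using that
  proof (induction c arbitrary: p t e rule: less_induct)
    case (less c)
    obtain t' e' where "enters p 2 t' e'" "closed S (ocons S t')" "x p 3 = Some (oresp S (ocons S t'))"
      using x_3[OF less.prems(1)] by blast
    then have "closed S c" "oresp S c = B0"
      using less.prems all0[of p] enters_unique by (metis, metis option.inject)
    then obtain q where "Wq alg V S c q = Some B0"
      using oresp_B0 assms(1) by blast
    then show False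
      using Wq_B0 no less.IH by blast
  qed
  then show False using x_3[OF assms(2)] assms(2) by blast
qed

section \<open>Agreement and validity\<close>

lemma obtain_quorum:
  assumes "reached p (Suc k)" "k \<noteq> 2"
  obtains Q b where "Q \<subseteq> \<Pi>" "card \<Pi> - f \<le> card Q" "\<And>q. q \<in> Q \<Longrightarrow> reached q k"
    "x p (Suc k) = upd k (x p 2) b ((\<lambda>q. x q k) ` Q)"
  using reached_quorum[OF assms] by blast

text \<open>Round 2 is excluded because it is left with the oracle answer, round 3 because it also
  weighs the certain value \<open>x p 2\<close>.\<close>

lemma unanimity_step:
  assumes "\<And>q. reached q k \<Longrightarrow> x q k = Some v" and "k \<noteq> 2" "k \<noteq> 3" and "reached p (Suc k)"
  shows "x p (Suc k) = Some v"
proof -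
  obtain Q b where Q: "card \<Pi> - f \<le> card Q" "\<And>q. q \<in> Q \<Longrightarrow> reached q k"
    "x p (Suc k) = upd k (x p 2) b ((\<lambda>q. x q k) ` Q)"
    using obtain_quorum[OF assms(4,2)] by metis
  have "(\<lambda>q. x q k) ` Q = {Some v}"
    using Q assms(1) quorum_nonempty[OF Q(1)] by auto
  then show ?thesis using Q(3) assms(2,3) by (cases v) (auto simp: upd_def unan_def)
qed

lemma unanimity_persists:
  assumes "\<And>q. reached q k \<Longrightarrow> x q k = Some v" and "4 \<le> k" "k \<le> j" and "reached p j"
  shows "x p j = Some v"
  using assms(3,4)
proof (induction j arbitrary: p rule: dec_induct)
  case (step j)
  then show ?case using unanimity_step[of j v p] assms(2) by auto
qed (rule assms(1))

lemma unanimity_decides: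
  assumes "\<And>q. reached q k \<Longrightarrow> x q k = Some v" and "odd k" "5 \<le> k" and "reached p (Suc k)"
  shows "\<exists>t. verdict (st t p) \<noteq> None"
proof -
  have "k \<noteq> 2" using assms(3) by simp
  from reached_quorum[OF assms(4) this] obtain Q where Q: "card \<Pi> - f \<le> card Q" "\<forall>q \<in> Q. reached q k"
    "unan ((\<lambda>q. x q k) ` Q) \<noteq> None \<longrightarrow> (\<exists>t. verdict (st t p) \<noteq> None)"
    using assms(2,3) by blast
  moreover have "(\<lambda>q. x q k) ` Q = {Some v}"
    using Q assms(1) quorum_nonempty[OF Q(1)] by auto
  ultimately show ?thesis by (cases v) (auto simp: unan_def)
qed

text \<open>Each proposal is the unanimous estimate of a quorum, and a process common to both
  quorums has just one estimate.\<close>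

lemma proposal_unique:
  assumes "odd k" "5 \<le> k" "reached p k" "reached q k" "x p k = Some v" "x q k = Some w"
  shows "v = w"
proof -
  obtain j where j: "k = Suc j" "even j" "4 \<le> j" using assms(1,2) by (cases k) auto
  then have "j \<noteq> 2" by simp
  have upd: "upd j a b M = unan M" for a b M using j by (auto simp: upd_def)
  obtain Q where Q: "Q \<subseteq> \<Pi>" "card \<Pi> - f \<le> card Q" "x p k = unan ((\<lambda>q. x q j) ` Q)"
    using obtain_quorum[of p j] assms(3) j \<open>j \<noteq> 2\<close> upd by metis
  obtain Q' where Q': "Q' \<subseteq> \<Pi>" "card \<Pi> - f \<le> card Q'" "x q k = unan ((\<lambda>q. x q j) ` Q')"
    using obtain_quorum[of q j] assms(4) j \<open>j \<noteq> 2\<close> upd by metis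
  obtain r where r: "r \<in> Q" "r \<in> Q'" using quorums_meet[of Q Q'] Q Q' by blast
  have "(\<lambda>q. x q j) ` Q = {Some v}" "(\<lambda>q. x q j) ` Q' = {Some w}"
    using Q(3) Q'(3) assms(5,6) unan_Some_iff by metis+
  with r have "x r j = Some v" "x r j = Some w" by blast+
  then show ?thesis by simp
qed

text \<open>Every quorum meets \<open>Q\<close> and so sees \<open>v\<close>; by
  \<open>proposal_unique\<close> it sees no other proposal.\<close>

lemma decision_locks:
  assumes "odd k" "5 \<le> k" "Q \<subseteq> \<Pi>" "card \<Pi> - f \<le> card Q" "\<forall>q \<in> Q. reached q k \<and> x q k = Some v"
    and "reached p (Suc k)"
  shows "x p (Suc k) = Some v"
proof -
  have "k \<noteq> 2" using assms(2) by simp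
  obtain Q' b where Q': "Q' \<subseteq> \<Pi>" "card \<Pi> - f \<le> card Q'" "\<And>q. q \<in> Q' \<Longrightarrow> reached q k"
    "x p (Suc k) = upd k (x p 2) b ((\<lambda>q. x q k) ` Q')"
    using obtain_quorum[OF assms(6) \<open>k \<noteq> 2\<close>] by metis
  obtain r where r: "r \<in> Q" "r \<in> Q'" using quorums_meet[of Q Q'] assms(3,4) Q' by blast
  have "Some v \<in> (\<lambda>q. x q k) ` Q'" using r assms(5) by force
  moreover have "w = v" if w: "Some w \<in> (\<lambda>q. x q k) ` Q'" for w
  proof -
    obtain q where "q \<in> Q'" "x q k = Some w" using w by force
    then show ?thesis using Q'(3) proposal_unique[OF assms(1,2), of q r w v] assms(5) r by blast
  qed
  moreover have "upd k a b M = (if Some B1 \<in> M then Some B1 else Some B0)" for a b M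
    using assms(1,2) by (auto simp: upd_def)
  ultimately show ?thesis using Q'(4) by (metis (full_types) bit.exhaust)
qed

text \<open>The smaller of the two deciding rounds locks its value, which then persists up to the
  larger one.\<close>

lemma verdict_agreement:
  assumes "verdict (st t p) = Some v" "verdict (st t' q) = Some w"
  shows "v = w"
proof -
  have *: "v = w" if h: "odd k" "5 \<le> k" "Q \<subseteq> \<Pi>" "card \<Pi> - f \<le> card Q" "\<forall>q \<in> Q. reached q k \<and> x q k = Some v"
    "Q' \<subseteq> \<Pi>" "card \<Pi> - f \<le> card Q'" "\<forall>q \<in> Q'. reached q j \<and> x q j = Some w" "k \<le> j" for k j Q Q' v w
  proof (cases "k = j")
    case True
    then show ?thesis using quorums_meet[of Q Q'] h by force
  next
    case False
    obtain r where "r \<in> Q'" using quorum_nonempty h(7) by blast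
    then show ?thesis
      using unanimity_persists[of "Suc k" v j r] decision_locks[OF h(1-5)] False h(2,8,9) by auto
  qed
  obtain k Q where k: "odd k" "5 \<le> k" "Q \<subseteq> \<Pi>" "card \<Pi> - f \<le> card Q"
    "\<forall>q \<in> Q. reached q k \<and> x q k = Some v"
    using verdict_quorum[OF assms(1)] by blast
  obtain j Q' where j: "odd j" "5 \<le> j" "Q' \<subseteq> \<Pi>" "card \<Pi> - f \<le> card Q'"
    "\<forall>q \<in> Q'. reached q j \<and> x q j = Some w"
    using verdict_quorum[OF assms(2)] by blast
  show ?thesis
    using *[OF k j(3-5)] *[OF j k(3-5)] nat_le_linear[of k j] by blast
qed

lemma verdict_unanimous:
  assumes "\<And>q. reached q 4 \<Longrightarrow> x q 4 = Some w" "verdict (st t p) = Some v"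
  shows "v = w"
proof -
  obtain k Q where k: "5 \<le> k" "card \<Pi> - f \<le> card Q" "\<forall>q \<in> Q. reached q k \<and> x q k = Some v"
    using verdict_quorum[OF assms(2)] by blast
  then obtain r where "r \<in> Q" using quorum_nonempty by blast
  then show ?thesis using k unanimity_persists[of 4 w k r] assms(1) by auto
qed

section \<open>Estimates in round 4: unanimity and validity\<close>

lemma x_4:
  assumes "reached p 4"
  obtains Q where "Q \<subseteq> \<Pi>" "card \<Pi> - f \<le> card Q" "\<And>q. q \<in> Q \<Longrightarrow> reached q 3"
    "x p 4 = (if (\<exists>q \<in> Q. x q 3 = Some B1) \<or> x p 2 = Some B1 then Some B1 else Some B0)"
proof -
  have "reached p (Suc 3)" using assms by (simp add: numeral_eq_Suc)
  then obtain Q b where Q: "Q \<subseteq> \<Pi>" "card \<Pi> - f \<le> card Q" "\<And>q. q \<in> Q \<Longrightarrow> reached q 3"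
    "x p (Suc 3) = upd 3 (x p 2) b ((\<lambda>q. x q 3) ` Q)"
    using obtain_quorum[of p 3] by auto
  have "upd 3 (x p 2) b ((\<lambda>q. x q 3) ` Q) =
    (if (\<exists>q \<in> Q. x q 3 = Some B1) \<or> x p 2 = Some B1 then Some B1 else Some B0)"
    by (auto simp: upd_def image_iff eq_commute)
  with Q show ?thesis using that[of Q] by simp
qed

lemma x_2:
  assumes "reached p 2"
  obtains Q where "Q \<subseteq> \<Pi>" "card \<Pi> - f \<le> card Q" "\<And>q. q \<in> Q \<Longrightarrow> reached q 1"
    "x p 2 = unan ((\<lambda>q. x q 1) ` Q)"
proof -
  have "reached p (Suc 1)" using assms by (simp add: numeral_eq_Suc)
  then obtain Q b where Q: "Q \<subseteq> \<Pi>" "card \<Pi> - f \<le> card Q" "\<And>q. q \<in> Q \<Longrightarrow> reached q 1"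
    "x p (Suc 1) = upd 1 (x p 2) b ((\<lambda>q. x q 1) ` Q)"
    using obtain_quorum[of p 1] by auto
  then show ?thesis using that[of Q] by (simp add: upd_def numeral_2_eq_2)
qed

text \<open>If some first answer is 1, every quorum contains one. Otherwise only a certain 1 could
  raise an estimate to 1, and the certain 0 that caused the answers 0 excludes it.\<close>

lemma few_faults_unanimous:
  assumes "card (Faulty F) < f"
  shows "\<exists>v. \<forall>p. reached p 4 \<longrightarrow> x p 4 = Some v"
proof (cases "\<exists>q. reached q 3 \<and> x q 3 = Some B1")
  case True
  then obtain q where q: "reached q 3" "x q 3 = Some B1" by blast
  have "x p 4 = Some B1" if p: "reached p 4" for p
    using x_4[OF p] quorum_sees_B1[OF q] by metis
  then show ?thesis by blast
next
  case False
  have all0: "x q 3 = Some B0" if "reached q 3" for q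
    using x_3[OF that] False that by (metis bit.exhaust)
  have "x p 4 = Some B0" if p: "reached p 4" for p
  proof -
    have p3: "reached p 3" and p2: "reached p 2" using reached_le[OF p] by auto
    obtain q where q: "reached q 2" "x q 2 = Some B0"
      using x_3_B0_cause[OF assms p3 all0] by blast
    obtain Q where Q: "Q \<subseteq> \<Pi>" "card \<Pi> - f \<le> card Q" "x q 2 = unan ((\<lambda>q. x q 1) ` Q)"
      using x_2[OF q(1)] by metis
    obtain Q' where Q': "Q' \<subseteq> \<Pi>" "card \<Pi> - f \<le> card Q'" "x p 2 = unan ((\<lambda>q. x q 1) ` Q')"
      using x_2[OF p2] by metis
    \<comment> \<open>A process common to the two round-1 quorums prevents a certain 0 and a certain
      1 from coexisting.\<close>
    obtain r where r: "r \<in> Q" "r \<in> Q'" using quorums_meet[of Q Q'] Q Q' by blast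
    have "(\<lambda>q. x q 1) ` Q = {Some B0}" using Q(3) q(2) unan_Some_iff by metis
    then have "x r 1 = Some B0" using r by blast
    then have "(\<lambda>q. x q 1) ` Q' \<noteq> {Some B1}" using r by force
    then have "x p 2 \<noteq> Some B1" using Q'(3) unan_Some_iff by metis
    then show ?thesis using x_4[OF p] all0 by (metis bit.distinct(1) option.inject)
  qed
  then show ?thesis by blast
qed

text \<open>With exactly \<open>f\<close> faults the oracle may answer 0 even here; the certain 1 of
  round 2 overrides such an answer.\<close>

lemma all_ones_unanimous:
  assumes "\<forall>p \<in> \<Pi>. V p = B1" and "reached p 4"
  shows "x p 4 = Some B1"
proof -
  have "x q 0 = Some B1" if "reached q 0" for q using x_0 that assms(1) reached_Pi by metis
  then have "x q 1 = Some B1" if "reached q 1" for q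
    using unanimity_step[of 0 B1 q] that by simp
  then have "x q 2 = Some B1" if "reached q 2" for q
    using unanimity_step[of 1 B1 q] that by (simp add: numeral_2_eq_2)
  then have "x p 2 = Some B1" using reached_le[OF assms(2), of 2] by simp
  then show ?thesis using x_4[OF assms(2)] by metis
qed

text \<open>A quorum misses at most \<open>f\<close> processes, hence contains one of the
  \<open>f + 1\<close> zeros. All values of round 2 are then a certain 0, so no query is 1, while an
  answer 1 would require one.\<close>

lemma many_zeros_unanimous:
  assumes "f + 1 \<le> card {p \<in> \<Pi>. V p = B0}" and "reached p 4"
  shows "x p 4 = Some B0"
proof -
  let ?Z = "{p \<in> \<Pi>. V p = B0}"
  have x1: "x q 1 = Some B0" if q: "reached q 1" for q
  proof -
    have "reached q (Suc 0)" using q by simp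
    then obtain Q b where Q: "Q \<subseteq> \<Pi>" "card \<Pi> - f \<le> card Q" "\<And>q. q \<in> Q \<Longrightarrow> reached q 0"
      "x q (Suc 0) = upd 0 (x q 2) b ((\<lambda>q. x q 0) ` Q)"
      using obtain_quorum[of q 0] by auto
    have "Q \<inter> ?Z \<noteq> {}"
    proof
      assume "Q \<inter> ?Z = {}"
      then have "card Q + card ?Z = card (Q \<union> ?Z)"
        using Q(1) finite_Pi card_Un_disjoint[of Q ?Z] finite_subset[of Q \<Pi>] by auto
      also have "\<dots> \<le> card \<Pi>" using Q(1) finite_Pi by (intro card_mono) auto
      finally show False using Q(2) assms(1) majority by linarith
    qed
    then obtain r where "r \<in> Q" "V r = B0" by blast
    then have "Some B0 \<in> (\<lambda>q. x q 0) ` Q" using x_0 Q(3) by force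
    then show ?thesis using Q(4) by (simp add: upd_def)
  qed
  then have x2: "x q 2 = Some B0" if "reached q 2" for q
    using unanimity_step[of 1 B0 q] that by (simp add: numeral_2_eq_2)
  have x3: "x q 3 \<noteq> Some B1" if q: "reached q 3" for q
  proof
    assume "x q 3 = Some B1"
    then obtain c where "closed S c" "oresp S c = B1" using x_3[OF q] by auto
    then have "{p \<in> \<Pi>. Wq alg V S c p = Some B1} \<noteq> {}"
      using oresp_B1[of c] by (metis card.empty not_less_zero)
    then obtain r where r: "Wq alg V S c r = Some B1" by blast
    then show False using Wq_B1[OF r] x2 entersD(2) by blast
  qed
  have "x p 2 = Some B0" using x2 reached_le[OF assms(2)] by simp
  then show ?thesis using x_4[OF assms(2)] x3 by (metis bit.distinct(1) option.inject)
qed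

lemma verdict_valid:
  assumes "verdict (st t p) = Some v"
  shows "v \<in> kTAg (f + 1) \<Pi> F V"
proof -
  have "v = B0" if "f + 1 \<le> card {p \<in> \<Pi>. V p = B0}"
    using verdict_unanimous[OF many_zeros_unanimous assms] that by blast
  moreover have "v = B1" if "\<forall>p \<in> \<Pi>. V p = B1"
    using verdict_unanimous[OF all_ones_unanimous assms] that by blast
  ultimately show ?thesis
    by (cases v) (auto simp: kTAg_def)
qed

section \<open>Termination\<close>

lemma correct_Pi: "correct \<Pi> F \<subseteq> \<Pi>"
  by (auto simp: correct_def)

lemma card_correct: "card (correct \<Pi> F) = card \<Pi> - card (Faulty F)"
proof -
  have "Faulty F \<subseteq> \<Pi>" using pattern by (auto simp: failure_pattern_def Faulty_def)
  then show ?thesis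
    using finite_Pi by (simp add: correct_def card_Diff_subset finite_subset)
qed

lemma delivered:
  assumes "p \<in> correct \<Pi> F" "reached q k"
  shows "\<exists>t. idx q \<in> heard (st t p) k"
proof -
  obtain t e where te: "enters q k t e" using reached_enters[OF assms(2)] by blast
  have out: "sends_at alg V S t = map (\<lambda>r. (r, to_nat (k, x q k))) procs"
    using te entersD(3)[OF te] by (simp add: sends_at_step enters_def outbox_def)
  have "p \<in> set procs" using assms(1) correct_Pi set_procs by blast
  then obtain j where j: "j < length procs" "procs ! j = p" by (auto simp: in_set_conv_nth)
  then have "j < length (sends_at alg V S t)" "sends_at alg V S t ! j = (p, to_nat (k, x q k))"
    by (simp_all add: out)
  from run_reliable[OF this assms(1)] obtain t' q' where
    t': "sched S t' = Some (p, Msg q' (to_nat (k, x q k)))" "msg_src S t' = (t, j)" by blast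
  then have "q' = q" using run_received(1)[OF t'] te by (auto simp: enters_def)
  then have "(idx q, k, x q k) \<in> set (rcvd (st (Suc t') p))"
    using t'(1) by (simp add: st_step after_rcvd absorb_def)
  then show ?thesis by (auto simp: heard_def)
qed

lemma heard_mono: "t \<le> t' \<Longrightarrow> heard (st t p) k \<subseteq> heard (st t' p) k"
  using rcvd_mono[of t t' p] by (auto simp: heard_def)

lemma heard_absorb: "heard s k \<subseteq> heard (absorb s e) k"
  by (auto simp: heard_def absorb_def split: event.split)

lemma finite_heard: "finite (heard s k)"
proof (rule finite_subset)
  show "heard s k \<subseteq> fst ` set (rcvd s)" by (force simp: heard_def)
qed simp

lemma stuck_length:
  assumes "reached p k" "\<not> reached p (Suc k)"
  obtains t where "\<And>t'. t \<le> t' \<Longrightarrow> length (hist (st t' p)) = Suc k"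
proof -
  obtain t where t: "k < length (hist (st t p))" using assms(1) by (auto simp: reached_def)
  have "length (hist (st t' p)) = Suc k" if "t \<le> t'" for t'
    using assms(2) t length_hist_mono[OF that, of p] unfolding reached_def
    by (meson le_antisym not_less_eq_eq not_le_imp_less order_less_le_trans Suc_leI)
  then show ?thesis using that by blast
qed

text \<open>A process stuck in round \<open>k\<close> would eventually have heard all correct
  processes, and these form a quorum.\<close>

lemma progress_quorum:
  assumes "\<And>q. q \<in> correct \<Pi> F \<Longrightarrow> reached q k" "p \<in> correct \<Pi> F" "k \<noteq> 2"
  shows "reached p (Suc k)"
proof (rule ccontr)
  assume no: "\<not> reached p (Suc k)"
  let ?C = "correct \<Pi> F"
  obtain t1 where t1: "\<And>t'. t1 \<le> t' \<Longrightarrow> length (hist (st t' p)) = Suc k"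
    using stuck_length[OF assms(1)[OF assms(2)] no] by blast
  have "\<forall>q \<in> ?C. \<exists>t. idx q \<in> heard (st t p) k"
    using delivered assms(1,2) by blast
  then obtain T where T: "\<And>q. q \<in> ?C \<Longrightarrow> idx q \<in> heard (st (T q) p) k" by metis
  have fin: "finite ?C" using finite_Pi correct_Pi finite_subset by blast
  \<comment> \<open>A step after all these deliveries, taken while \<open>p\<close> is already
    waiting in round \<open>k\<close>.\<close>
  obtain t e where t: "max t1 (Max (T ` ?C)) \<le> t" "sched S t = Some (p, e)"
    using run_fair[OF assms(2)] by blast
  have "idx ` ?C \<subseteq> heard (absorb (st t p) e) k"
  proof
    fix i assume "i \<in> idx ` ?C"
    then obtain q where q: "q \<in> ?C" "i = idx q" by blast
    then have "T q \<le> t" using t(1) fin by (meson Max_ge finite_imageI imageI le_trans max.boundedE)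
    then show "i \<in> heard (absorb (st t p) e) k"
      using T[OF q(1)] q(2) heard_mono heard_absorb by blast
  qed
  then have "card (idx ` ?C) \<le> card (heard (absorb (st t p) e) k)"
    using finite_heard by (rule card_mono[rotated])
  moreover have "card (idx ` ?C) = card ?C"
    using inj_idx correct_Pi by (meson card_image inj_on_subset)
  ultimately have "card \<Pi> - f \<le> card (heard (absorb (st t p) e) k)"
    using card_correct resilience by linarith
  then have "enters p (Suc k) t e"
    using t t1[of t] assms(3) by (simp add: enters_def ready_def)
  then show False using entersD(2) no by blast
qed

text \<open>If the consultation of the first query of \<open>p\<close> stayed open, every correct
  process would query in it, and resilience would close it.\<close>

lemma progress_oracle:
  assumes all: "\<And>q. q \<in> correct \<Pi> F \<Longrightarrow> reached q 2" and p: "p \<in> correct \<Pi> F"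
  shows "reached p 3"
proof -
  obtain tp ep where tp: "enters p 2 tp ep" using reached_enters[OF all[OF p]] by blast
  let ?c = "ocons S tp"
  have answered_if: "\<exists>t. answer (st t q) \<noteq> None"
    if q: "enters q 2 t e" "closed S (ocons S t)" "q \<in> correct \<Pi> F" for q t e
  proof -
    obtain t' d where "sched S t' = Some (q, Resp d)"
      using run_answered[OF q(2,3) enters_query[OF q(1)]] by blast
    then have "answer (st (Suc t') q) \<noteq> None"
      by (simp add: st_step after_def absorb_def)
    then show ?thesis by blast
  qed
  have "closed S ?c"
  proof (rule ccontr)
    assume "\<not> closed S ?c"
    then have le: "ocons S t \<le> ?c" for t by (simp add: closed_def not_less)
    have "Wq alg V S ?c q \<noteq> None" if q: "q \<in> correct \<Pi> F" for q
    proof -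
      obtain t e where te: "enters q 2 t e" using reached_enters[OF all[OF q]] by blast
      show ?thesis
      proof (cases "ocons S t = ?c")
        case True
        then show ?thesis using enters_query[OF te] by simp
      next
        case False
        \<comment> \<open>The first query of \<open>q\<close> went to an earlier, closed
          consultation. Once answered, \<open>q\<close> queries \<open>B0\<close> at every step,
          also while \<open>?c\<close> is open.\<close>
        then have "closed S (ocons S t)" using le[of t] unfolding closed_def by (metis le_neq_implies_less)
        then obtain t1 b where t1: "answer (st t1 q) = Some b" using answered_if[OF te _ q] by blast
        obtain t2 e2 where t2: "max t1 tp \<le> t2" "sched S t2 = Some (q, e2)"
          using run_fair[OF q] by blast
        have "answer (st t2 q) = Some b" using answer_mono[of t1 t2 q b] t1 t2(1) by simp
        then have "query (st t2 q) e2 = Some B0"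
          by (auto simp: query_def absorb_def split: event.split)
        then have "qout alg V S t2 q = Some B0" using t2(2) qout_eq_Some_iff by blast
        moreover have "ocons S t2 = ?c" using le[of t2] ocons_mono[of tp t2] t2(1) by simp
        ultimately show ?thesis using qout_Wq[of t2 q] by simp
      qed
    qed
    then have "correct \<Pi> F \<subseteq> {p \<in> \<Pi>. Wq alg V S ?c p \<noteq> None}" using correct_Pi by blast
    then have "card (correct \<Pi> F) \<le> card {p \<in> \<Pi>. Wq alg V S ?c p \<noteq> None}"
      using finite_Pi by (intro card_mono) auto
    then have "card \<Pi> - f \<le> card {p \<in> \<Pi>. Wq alg V S ?c p \<noteq> None}"
      using card_correct resilience by linarith
    then show False using run_closed \<open>\<not> closed S ?c\<close> by blast
  qed
  then show ?thesis using answered_if[OF tp _ p] answered(2) by blast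
qed

lemma correct_reaches: "p \<in> correct \<Pi> F \<Longrightarrow> reached p k"
proof (induction k arbitrary: p)
  case 0
  obtain t e where te: "sched S t = Some (p, e)" using run_fair[OF 0] by blast
  show ?case
  proof (cases "hist (st t p) = []")
    case True
    then have "enters p 0 t e" using te by (simp add: enters_def ready_def)
    then show ?thesis by (rule entersD)
  next
    case False
    then show ?thesis unfolding reached_def by blast
  qed
next
  case (Suc k)
  then show ?case
    using progress_quorum[of k p] progress_oracle[of p] by (cases "k = 2") (auto simp: numeral_3_eq_3)
qed

text \<open>A crashed process takes no steps, so its history keeps the length that it has at
  \<open>t0\<close>.\<close>

lemma faulty_stops:
  assumes "q \<in> Faulty F"
  shows "\<exists>k. \<not> reached q k"
proof -
  obtain t0 where t0: "q \<in> F t0" using assms by (auto simp: Faulty_def)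
  have "\<not> reached q (length (hist (st t0 q)))"
  proof
    assume "reached q (length (hist (st t0 q)))"
    then obtain t e where te: "enters q (length (hist (st t0 q))) t e" using reached_enters by blast
    have "q \<notin> F t" using te run_sched by (auto simp: enters_def)
    then have "t < t0" using t0 pattern by (metis failure_pattern_def leI monoD subsetD)
    then show False
      using length_hist_mono[of "Suc t" t0 q] entersD(1)[OF te] te by (simp add: enters_def)
  qed
  then show ?thesis by blast
qed

lemma eventually_only_correct: "\<exists>K. \<forall>q k. K \<le> k \<longrightarrow> reached q k \<longrightarrow> q \<in> correct \<Pi> F"
proof -
  obtain h where h: "\<And>q. q \<in> Faulty F \<Longrightarrow> \<not> reached q (h q)" using faulty_stops by metis
  have "finite (Faulty F)"
    using pattern finite_Pi by (auto simp: failure_pattern_def Faulty_def intro: finite_subset)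
  then have le: "h q \<le> Max (h ` Faulty F)" if "q \<in> Faulty F" for q using that by simp
  \<comment> \<open>Without faulty processes the maximum is unspecified, but then any bound will
    do.\<close>
  have "q \<in> correct \<Pi> F" if "Max (h ` Faulty F) \<le> k" "reached q k" for q k
    using that le h reached_le reached_Pi unfolding correct_def by (meson DiffI le_trans)
  then show ?thesis by blast
qed

text \<open>With exactly \<^term>\<open>f\<close> faults, the only quorum left after all crashes is the set of correct
  processes, so in late rounds all of them compute the same value.\<close>

lemma max_faults_decides:
  assumes "card (Faulty F) = f" "p \<in> correct \<Pi> F"
  shows "\<exists>t. verdict (st t p) \<noteq> None"
proof -
  let ?C = "correct \<Pi> F"
  obtain K where K: "\<And>q k. K \<le> k \<Longrightarrow> reached q k \<Longrightarrow> q \<in> ?C" using eventually_only_correct by blast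
  \<comment> \<open>An even round, which carries estimates, that is at least \<open>K\<close> and
    past the oracle rounds.\<close>
  define k where "k = 2 * K + 4"
  have k: "even k" "4 \<le> k" "K \<le> k" by (simp_all add: k_def)
  have fin: "finite ?C" using finite_Pi correct_Pi finite_subset by blast
  \<comment> \<open>There are exactly \<open>card \<Pi> - f\<close> correct processes, so a quorum
    of correct processes contains all of them.\<close>
  have only: "Q = ?C" if "card \<Pi> - f \<le> card Q" "\<And>q. q \<in> Q \<Longrightarrow> reached q j" "k \<le> j" for Q j
    using that K[of j] k(3) card_correct assms(1) fin
    by (intro card_seteq) auto
  have step: "\<exists>b. x q (Suc j) = upd j (x q 2) b ((\<lambda>q. x q j) ` ?C)"
    if q: "reached q (Suc j)" "k \<le> j" for q j
  proof -
    have "j \<noteq> 2" using q(2) k by simp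
    then obtain Q b where "card \<Pi> - f \<le> card Q" "\<And>q. q \<in> Q \<Longrightarrow> reached q j"
      "x q (Suc j) = upd j (x q 2) b ((\<lambda>q. x q j) ` Q)"
      using obtain_quorum[OF q(1)] by metis
    then show ?thesis using only q(2) by metis
  qed
  define u where "u = unan ((\<lambda>q. x q k) ` ?C)"
  have u: "x q (Suc k) = u" if "reached q (Suc k)" for q
    using step[OF that] k by (auto simp: upd_def u_def)
  show ?thesis
  proof (cases u)
    case (Some v)
    then show ?thesis
      using unanimity_decides[of "Suc k" v p] u k correct_reaches[OF assms(2)] by auto
  next
    case None
    \<comment> \<open>Without proposals every process falls back on the default estimate
      \<open>B0\<close>, so the next phase starts unanimously.\<close>
    have "x q (Suc (Suc k)) = Some B0" if q: "reached q (Suc (Suc k))" for q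
    proof -
      have "Some B1 \<notin> (\<lambda>q. x q (Suc k)) ` ?C"
        using u None correct_reaches by auto
      then show ?thesis using step[OF q] k by (auto simp: upd_def)
    qed
    then have "x q (Suc (Suc (Suc k))) = Some B0" if "reached q (Suc (Suc (Suc k)))" for q
      using unanimity_persists[of "Suc (Suc k)" B0 "Suc (Suc (Suc k))" q] that k by auto
    then show ?thesis
      using unanimity_decides[of "Suc (Suc (Suc k))" B0 p] k correct_reaches[OF assms(2)] by auto
  qed
qed

lemma few_faults_decides:
  assumes "card (Faulty F) < f" "p \<in> correct \<Pi> F"
  shows "\<exists>t. verdict (st t p) \<noteq> None"
proof -
  obtain v where "\<And>q. reached q 4 \<Longrightarrow> x q 4 = Some v" using few_faults_unanimous[OF assms(1)] by blast
  then have "x q 5 = Some v" if "reached q 5" for q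
    using unanimity_persists[of 4 v 5 q] that by simp
  then show ?thesis using unanimity_decides[of 5 v p] correct_reaches[OF assms(2)] by simp
qed

lemma correct_decides: "p \<in> correct \<Pi> F \<Longrightarrow> \<exists>t. verdict (st t p) \<noteq> None"
  using few_faults_decides max_faults_decides resilience by fastforce

end

section \<open>From single runs to tasks\<close>

context protocol
begin

lemma decision_alg: "decision alg p (state alg V S t p) = verdict (from_nat (state alg V S t p))"
  by (simp add: alg_def)

lemma alg_solves: "solves alg \<Pi> (kTAg_task (f + 1) \<Pi> f) (kTAg_task f \<Pi> f)"
  unfolding solves_def kTAg_task_def fst_conv snd_conv
proof (intro allI impI)
  fix F V S
  assume "failure_pattern \<Pi> F" "card (Faulty F) \<le> f" "is_run alg \<Pi> (kTAg f \<Pi>) f F V S"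
  then interpret protocol_run \<Pi> f idx procs F V S by unfold_locales
  have dec: "decision alg p (state alg V S t p) = verdict (st t p)" for p t
    by (simp add: decision_alg st_def)
  show "(\<forall>p \<in> correct \<Pi> F. \<exists>t. decision alg p (state alg V S t p) \<noteq> None) \<and>
       (\<forall>p \<in> \<Pi>. \<forall>t t' b. t \<le> t' \<longrightarrow> decision alg p (state alg V S t p) = Some b \<longrightarrow>
           decision alg p (state alg V S t' p) = Some b) \<and>
       (\<forall>p \<in> \<Pi>. \<forall>q \<in> \<Pi>. \<forall>t t' a b. decision alg p (state alg V S t p) = Some a \<longrightarrow>
           decision alg q (state alg V S t' q) = Some b \<longrightarrow> a = b) \<and>
       (\<forall>p \<in> \<Pi>. \<forall>t b. decision alg p (state alg V S t p) = Some b \<longrightarrow> b \<in> kTAg (f + 1) \<Pi> F V)"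
    unfolding dec
  proof (intro conjI ballI allI impI)
    show "\<exists>t. verdict (st t p) \<noteq> None" if "p \<in> correct \<Pi> F" for p
      using that by (rule correct_decides)
    show "verdict (st t' p) = Some b" if "t \<le> t'" "verdict (st t p) = Some b" for p t t' b
      using verdict_mono that by blast
    show "a = b" if "verdict (st t p) = Some a" "verdict (st t' q) = Some b" for p q t t' a b
      using that by (rule verdict_agreement)
    show "b \<in> kTAg (f + 1) \<Pi> F V" if "verdict (st t p) = Some b" for p t b
      using that by (rule verdict_valid)
  qed
qed

end

lemma ex_solves_kTAg_Suc:
  assumes "1 \<le> f" "2 * f < card \<Pi>"
  shows "\<exists>A. solves A \<Pi> (kTAg_task (f + 1) \<Pi> f) (kTAg_task f \<Pi> f)"
proof -
  have "finite \<Pi>" using assms by (metis card.infinite not_less_zero)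
  then obtain procs where procs: "set procs = \<Pi>" using finite_list by blast
  obtain idx :: "'a \<Rightarrow> nat" where "inj_on idx \<Pi>"
    using finite_imp_inj_to_nat_seg[OF \<open>finite \<Pi>\<close>] by blast
  then interpret protocol \<Pi> f idx procs using procs assms by unfold_locales
  show ?thesis using alg_solves by blast
qed

text \<open>If the number of zeros lies between the thresholds, 0 must stay allowed for
  \<open>k'\<close>, and it does because some input is 0. For all-ones inputs the bound on the
  faults forces 1 under both thresholds.\<close>

lemma kTAg_antimono:
  assumes "k \<le> k'" "card (Faulty F) < k"
  shows "kTAg k \<Pi> F V \<subseteq> kTAg k' \<Pi> F V"
proof -
  have "\<not> (\<forall>p \<in> \<Pi>. V p = B1)" if "k \<le> card {p \<in> \<Pi>. V p = B0}"
  proof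
    assume "\<forall>p \<in> \<Pi>. V p = B1"
    then have "card {p \<in> \<Pi>. V p = B0} = 0" by (simp add: card_eq_0_iff)
    with that assms(2) show False by linarith
  qed
  then show ?thesis using assms by (auto simp: kTAg_def)
qed

lemma solves_kTAg_mono:
  assumes "solves A \<Pi> (kTAg_task k \<Pi> f) T" "k \<le> k'" "f < k"
  shows "solves A \<Pi> (kTAg_task k' \<Pi> f) T"
proof -
  have "b \<in> kTAg k' \<Pi> F V" if "b \<in> kTAg k \<Pi> F V" "card (Faulty F) \<le> f" for b F V
    using kTAg_antimono[OF assms(2), of F \<Pi> V] that assms(3) by auto
  then show ?thesis
    using assms(1) unfolding solves_def kTAg_task_def fst_conv snd_conv by (smt (verit))
qed

theorem mainTheorem6:
  fixes n f :: nat and \<Pi> :: "'p set"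
  assumes "1 \<le> 2 * f" and "2 * f \<le> n - 1"
    and "finite \<Pi>" and "card \<Pi> = n"
  shows "(\<exists>A. solves A \<Pi> (kTAg_task (f + 1) \<Pi> f) (kTAg_task f \<Pi> f))
       \<and> creduces {1..n} (kTAg_task (f + 1) {1..n} f) (kTAg_task f {1..n} f)
       \<and> creduces {1..n} (Cons_task n f) (kTAg_task f {1..n} f)"
proof -
  \<comment> \<open>Subtraction truncates, but \<open>1 \<le> 2 * f\<close> forces
    \<open>n - 1\<close> to be positive.\<close>
  have f: "1 \<le> f" "2 * f < n" using assms(1,2) by linarith+
  obtain A where A: "solves A {1..n} (kTAg_task (f + 1) {1..n} f) (kTAg_task f {1..n} f)"
    using ex_solves_kTAg_Suc[of f "{1..n}"] f by auto
  \<comment> \<open>Consensus is the case of threshold \<open>n\<close>, and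
    \<open>f + 1 \<le> n\<close>.\<close>
  then have "solves A {1..n} (Cons_task n f) (kTAg_task f {1..n} f)"
    unfolding Cons_task_def using f by (intro solves_kTAg_mono[OF A]) auto
  with A show ?thesis
    using ex_solves_kTAg_Suc[of f \<Pi>] f assms(4) unfolding creduces_def by blast
qed

end
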